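(* Let $N,p,q$ be integers with $2<q\le p<N-2$, and let $A$ be a cyclically contiguous $p\times q$ submatrix of the $N\times N$ discrete Fourier matrix $F$. Let $\overline{q}$ be the largest even integer smaller than $q$, and let $\overline{p}$ be the smallest integer of the same parity as $N$ that is larger than $p$. Then the condition number of $A$ obeys $$\operatorname{cond}(A)\;\ge\;\frac{\sqrt{p}\,(1-\overline{p}/N)^{1/4}}{6\,\overline{q}^{1/4}\sqrt{N}}\;e^{\frac{\pi}{4}(1-\overline{p}/N)\,\overline{q}}.$$
   Context: The $N\times N$ discrete Fourier matrix is $F=(F_{jk})$, $F_{jk}=e^{2\pi i jk/N}$, with integer row and column indices $-N/2\le j,k<N/2$; index sets are regarded as $N$-periodic (i.e. as residues mod $N$). A cyclically contiguous $p\times q$ submatrix of $F$ is one whose row index set consists of $p$ cyclically consecutive residues mod $N$ and whose column index set consists of $q$ cyclically consecutive residues mod $N$. For a $p\times q$ matrix $A$ with singular values $\sigma_1\ge\sigma_2\ge\dots\ge\sigma_{\min(p,q)}=:\sigma_{\min}(A)$, the condition number is $\operatorname{cond}(A)=\sigma_1(A)/\sigma_{\min}(A)$. "Smaller" and "larger" are meant strictly. *)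

theory Defs
  imports
    Complex_Main
    "HOL-Number_Theory.Cong"
    "HOL-Library.Multiset"
    "Jordan_Normal_Form.Schur_Decomposition"
begin

definition dft_indices :: "nat \<Rightarrow> int set" where
  "dft_indices N = {j. - real N / 2 \<le> of_int j \<and> of_int j < real N / 2}"

definition dft_entry :: "nat \<Rightarrow> int \<Rightarrow> int \<Rightarrow> complex" where
  "dft_entry N j k = exp (2 * of_real pi * \<i> * of_int j * of_int k / of_nat N)"

definition cyclic_interval :: "nat \<Rightarrow> int \<Rightarrow> nat \<Rightarrow> int set" where
  "cyclic_interval N a n = {j \<in> dft_indices N. \<exists>i<n. [j = a + int i] (mod int N)}"

text \<open>
  Only the index sets of the submatrix are prescribed, so its rows and columns may be listed in any
  order: both the order inherited from \<^const>\<open>dft_indices\<close> and the cyclic order (which differ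
  when an index set wraps around) are allowed. The bijections also force the \<open>p\<close> row indices and the
  \<open>q\<close> column indices to be distinct residues.
\<close>

definition cyclic_dft_submatrix :: "nat \<Rightarrow> nat \<Rightarrow> nat \<Rightarrow> complex mat \<Rightarrow> bool" where
  "cyclic_dft_submatrix N p q A \<longleftrightarrow>
     (\<exists>a b r c. bij_betw r {..<p} (cyclic_interval N a p) \<and>
                bij_betw c {..<q} (cyclic_interval N b q) \<and>
                A = mat p q (\<lambda>(s, t). dft_entry N (r s) (c t)))"

text \<open>
  Square roots of the eigenvalues of \<open>A\<^sup>* A\<close> with multiplicity, in decreasing order. That matrix
  has \<open>dim_col A\<close> eigenvalues, all real and nonnegative; if \<open>dim_row A < dim_col A\<close>, the last
  \<open>dim_col A - dim_row A\<close> of them vanish and are not counted as singular values.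
\<close>

definition singular_values :: "complex mat \<Rightarrow> real list" where
  "singular_values A =
     take (min (dim_row A) (dim_col A))
       (rev (sorted_list_of_multiset
         (image_mset (\<lambda>z. sqrt (Re z)) (proots (char_poly (mat_adjoint A * A))))))"

text \<open>
  If the smallest singular value is \<open>0\<close>, this is \<open>0\<close> rather than \<open>\<infinity>\<close>, so any positive lower
  bound on it includes the claim that the smallest singular value is nonzero.
\<close>

definition condition_number :: "complex mat \<Rightarrow> real" where
  "condition_number A = hd (singular_values A) / last (singular_values A)"

definition largest_even_below :: "nat \<Rightarrow> nat" where
  "largest_even_below q = (GREATEST m. even m \<and> m < q)"

definition least_same_parity_above :: "nat \<Rightarrow> nat \<Rightarrow> nat" where
  "least_same_parity_above N p = (LEAST m. even m = even N \<and> p < m)"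

end

theory Submission
  imports Defs "HOL-Analysis.Function_Topology" "HOL-Analysis.Convex"
begin

text \<open>
  A column of \<open>A\<close> has norm \<open>sqrt p\<close>, so it suffices to exhibit \<open>v\<close> for which \<open>A v\<close> is small compared
  to \<open>v\<close>. Up to unimodular factors, \<open>A v\<close> lists the values of the polynomial with coefficient
  vector \<open>v\<close> at \<open>p\<close> consecutive \<open>N\<close>-th roots of unity. Take the Dolph--Chebyshev window: in terms of
  the Chebyshev polynomial \<open>T\<^sub>n\<close>, the polynomial \<open>P\<close> with
  \<open>P (e\<^bsup>2i\<theta>\<^esup>) = e\<^bsup>in\<theta>\<^esup> T\<^sub>n (b cos \<theta>)\<close>, \<open>n = q - 1\<close>, rotated so that \<open>\<theta> = 0\<close> lies opposite to
  the middle of the row interval. With \<open>b = cosh \<theta>\<^sub>0\<close>, \<open>\<theta>\<^sub>0 = (\<pi>/2) (1 - (p - 1)/N)\<close>, the inequality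
  \<open>cosh \<theta>\<^sub>0 cos \<theta>\<^sub>0 \<le> 1\<close> gives \<open>|P| \<le> 1\<close> at the nodes, while \<open>P 1 = cosh (n \<theta>\<^sub>0)\<close> forces the norm
  of the coefficient vector to be at least \<open>e\<^bsup>n\<theta>\<^sub>0\<^esup> / (2 sqrt q)\<close>. The resulting exponential rate
  is twice the one claimed, and the surplus absorbs all algebraic factors.
\<close>

subsection \<open>Extremal eigenvalues of Hermitian matrices\<close>

text \<open>A minimiser \<open>f\<close> on the unit sphere exists by compactness. With
  \<open>\<mu>\<close> the minimum, \<open>F g = Q g - \<mu> * nrm g\<close> is nonnegative and
  vanishes at \<open>f\<close>. Moving from \<open>f\<close> along the residual
  \<open>r = (h - \<mu>) f\<close> changes \<open>F\<close> to first order by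
  \<open>2 * e * nrm r\<close>, so the residual must vanish.\<close>

lemma hermitian_form_min:
  fixes h :: "nat \<Rightarrow> nat \<Rightarrow> complex" and n :: nat
  defines "Q \<equiv> \<lambda>g. Re (\<Sum>i<n. \<Sum>j<n. cnj (g i) * h i j * g j)"
  assumes n: "n > 0" and herm: "\<And>i j. i < n \<Longrightarrow> j < n \<Longrightarrow> h j i = cnj (h i j)"
  obtains \<mu> :: real and f where "(\<Sum>i<n. (cmod (f i))\<^sup>2) = 1"
    and "\<And>i. i < n \<Longrightarrow> (\<Sum>j<n. h i j * f j) = of_real \<mu> * f i"
    and "\<And>g. \<mu> * (\<Sum>i<n. (cmod (g i))\<^sup>2) \<le> Q g"
proof -
  define nrm where "nrm = (\<lambda>g::nat \<Rightarrow> complex. \<Sum>i<n. (cmod (g i))\<^sup>2)"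
  define D where "D = (\<lambda>(x, y). Complex x y) ` ({-1..1} \<times> {-1..1})"
  have "continuous_on ({-1..1} \<times> {-1..1}) (\<lambda>z. of_real (fst z) + \<i> * of_real (snd z))"
    by (intro continuous_intros)
  then have "compact D" unfolding D_def
    by (intro compact_continuous_image compact_Times)
      (auto simp: case_prod_beta' Complex_eq)
  have D: "z \<in> D" if "cmod z \<le> 1" for z
    using that abs_Re_le_cmod[of z] abs_Im_le_cmod[of z] unfolding D_def
    by (intro image_eqI[where x = "(Re z, Im z)"]) auto
  \<comment> \<open>Vectors are functions on all of \<open>nat\<close>. Pinning the coordinates from
    \<open>n\<close> on at 0 and confining the others to the square \<open>D\<close>, which contains
    the unit disc, makes \<open>K\<close> compact by Tychonoff; \<open>S\<close> is then the unit
    sphere of C^n.\<close>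
  define K where "K = (PiE UNIV (\<lambda>i. if i < n then D else {0}) :: (nat \<Rightarrow> complex) set)"
  define S where "S = K \<inter> nrm -` {1}"
  have "compactin (product_topology (\<lambda>i::nat. euclidean :: complex topology) UNIV) K"
    unfolding K_def compactin_PiE using \<open>compact D\<close> by auto
  then have "compact K" by (simp add: euclidean_product_topology)
  moreover have "continuous_on UNIV nrm"
    unfolding nrm_def by (intro continuous_intros continuous_on_product_coordinates)
  then have "closed (nrm -` {1})"
    by (rule closed_vimage[OF closed_singleton])
  ultimately have "compact S" unfolding S_def by (rule compact_Int_closed)
  moreover have "(\<lambda>i. if i = 0 then 1 else 0) \<in> S"
  proof -
    have "nrm (\<lambda>i. if i = 0 then 1 else 0) = (\<Sum>i<n. if i = 0 then 1 else 0)"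
      unfolding nrm_def by (intro sum.cong) auto
    then show ?thesis using n D[of 0] D[of 1] by (auto simp: S_def K_def)
  qed
  moreover have "continuous_on S Q"
    unfolding Q_def
    by (intro continuous_intros continuous_on_subset[OF continuous_on_product_coordinates]) auto
  ultimately obtain f where f: "f \<in> S" and fmin: "\<And>g. g \<in> S \<Longrightarrow> Q f \<le> Q g"
    using continuous_attains_inf[of S Q] by blast
  define \<mu> where "\<mu> = Q f"
  have f1: "nrm f = 1" using f by (auto simp: S_def)
  \<comment> \<open>Homogeneity carries the bound from \<open>S\<close> to every \<open>g\<close>;
    \<open>k\<close> is \<open>g\<close> normalised and cut off at \<open>n\<close>.\<close>
  have min: "\<mu> * nrm g \<le> Q g" for g
  proof (cases "nrm g = 0")
    case True
    then have "\<And>i. i < n \<Longrightarrow> g i = 0" by (auto simp: nrm_def sum_nonneg_eq_0_iff)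
    then have "Q g = 0" by (auto simp: Q_def)
    then show ?thesis using True by simp
  next
    case False
    have "nrm g \<ge> 0" by (auto simp: nrm_def intro: sum_nonneg)
    with False have pos: "nrm g > 0" by simp
    define c where "c = 1 / sqrt (nrm g)"
    have c2: "c * c = 1 / nrm g" using pos by (simp add: c_def flip: real_sqrt_mult)
    define k where "k = (\<lambda>i. if i < n then of_real c * g i else 0)"
    have "nrm k = (\<Sum>i<n. c * c * (cmod (g i))\<^sup>2)"
      unfolding nrm_def by (intro sum.cong) (auto simp: k_def norm_mult power_mult_distrib power2_eq_square)
    also have "\<dots> = c * c * nrm g" by (simp only: nrm_def sum_distrib_left)
    also have "\<dots> = 1" using pos c2 by simp
    finally have k1: "nrm k = 1" .
    have "cmod (k i) \<le> 1" if "i < n" for i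
    proof -
      have "(cmod (k i))\<^sup>2 \<le> nrm k" unfolding nrm_def by (rule member_le_sum) (use that in auto)
      then show ?thesis by (simp add: k1 abs_square_le_1)
    qed
    then have "k \<in> S" using k1 D by (auto simp: S_def K_def k_def)
    then have "\<mu> \<le> Q k" unfolding \<mu>_def by (rule fmin)
    also have "Q k = Re (\<Sum>i<n. \<Sum>j<n. of_real (c * c) * (cnj (g i) * h i j * g j))"
      unfolding Q_def by (intro arg_cong[where f = Re] sum.cong) (auto simp: k_def)
    also have "\<dots> = Re (of_real (c * c) * (\<Sum>i<n. \<Sum>j<n. cnj (g i) * h i j * g j))"
      by (simp only: sum_distrib_left)
    also have "\<dots> = Q g / nrm g" unfolding c2 by (simp add: Q_def)
    finally show ?thesis using pos by (simp add: field_simps)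
  qed
  define L where "L = (\<lambda>g i. (\<Sum>j<n. h i j * g j) - of_real \<mu> * g i)"
  define F where "F = (\<lambda>g. Q g - \<mu> * nrm g)"
  define r where "r = L f"
  have F_L: "F g = Re (\<Sum>i<n. cnj (g i) * L g i)" for g
  proof -
    have "of_real (\<mu> * nrm g) = (\<Sum>i<n. of_real \<mu> * (cnj (g i) * g i))"
      by (simp add: nrm_def complex_norm_square sum_distrib_left mult_ac del: of_real_power)
    moreover have "(\<Sum>i<n. cnj (g i) * L g i) =
        (\<Sum>i<n. \<Sum>j<n. cnj (g i) * h i j * g j) - (\<Sum>i<n. of_real \<mu> * (cnj (g i) * g i))"
      by (simp add: L_def algebra_simps sum_distrib_left sum_subtractf)
    ultimately have "(\<Sum>i<n. cnj (g i) * L g i) =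
        (\<Sum>i<n. \<Sum>j<n. cnj (g i) * h i j * g j) - of_real (\<mu> * nrm g)"
      by simp
    then show ?thesis by (simp only: F_def Q_def minus_complex.sel Re_complex_of_real)
  qed
  have self_adj: "(\<Sum>i<n. cnj (f i) * L r i) = (\<Sum>i<n. cnj (L f i) * r i)"
  proof -
    have "(\<Sum>i<n. \<Sum>j<n. cnj (f i) * (h i j * r j)) = (\<Sum>j<n. \<Sum>i<n. cnj (f i) * (h i j * r j))"
      by (rule sum.swap)
    also have "\<dots> = (\<Sum>j<n. \<Sum>i<n. cnj (h j i) * cnj (f i) * r j)"
    proof (intro sum.cong refl)
      fix i j assume "i \<in> {..<n}" "j \<in> {..<n}"
      then have "h i j = cnj (h j i)" by (intro herm) auto
      then show "cnj (f i) * (h i j * r j) = cnj (h j i) * cnj (f i) * r j" by simp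
    qed
    finally show ?thesis
      by (simp add: L_def algebra_simps sum_distrib_left sum_distrib_right sum_subtractf)
  qed
  \<comment> \<open>Since \<open>L\<close> is self-adjoint and \<open>r = L f\<close>, both cross
    terms equal \<open>e * nrm r\<close>.\<close>
  have expand: "F (\<lambda>i. f i + of_real e * r i) = 2 * e * nrm r + e\<^sup>2 * F r" for e :: real
  proof -
    have "L (\<lambda>i. f i + of_real e * k i) i = L f i + of_real e * L k i" for k i
      by (simp add: L_def algebra_simps sum.distrib sum_distrib_left)
    then have Llin: "L (\<lambda>i. f i + of_real e * r i) i = r i + of_real e * L r i" for i
      by (simp add: r_def)
    have nr: "(\<Sum>i<n. cnj (r i) * r i) = of_real (nrm r)"
      by (simp add: nrm_def complex_norm_square mult.commute del: of_real_power)
    have "(\<Sum>i<n. cnj (f i + of_real e * r i) * (r i + of_real e * L r i)) =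
        (\<Sum>i<n. cnj (f i) * L f i) + of_real e * (\<Sum>i<n. cnj (r i) * r i)
          + of_real e * (\<Sum>i<n. cnj (f i) * L r i) + of_real (e\<^sup>2) * (\<Sum>i<n. cnj (r i) * L r i)"
      by (simp add: r_def algebra_simps sum.distrib sum_distrib_left power2_eq_square)
    also have "\<dots> = (\<Sum>i<n. cnj (f i) * L f i) + of_real (2 * e * nrm r)
        + of_real (e\<^sup>2) * (\<Sum>i<n. cnj (r i) * L r i)"
      unfolding self_adj r_def[symmetric] nr by simp
    finally have "F (\<lambda>i. f i + of_real e * r i) = F f + 2 * e * nrm r + e\<^sup>2 * F r"
      unfolding F_L Llin by simp
    moreover have "F f = 0" by (simp add: F_def \<mu>_def f1)
    ultimately show ?thesis by simp
  qed
  have "nrm r = 0"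
  proof (rule ccontr)
    assume "nrm r \<noteq> 0"
    moreover have "nrm r \<ge> 0" by (auto simp: nrm_def intro: sum_nonneg)
    ultimately have R: "nrm r > 0" by simp
    \<comment> \<open>Negative, and small enough that
      \<open>\<bar>e * F r\<bar> \<le> nrm r\<close>: the linear term dominates and \<open>F\<close>
      would take a negative value.\<close>
    define e where "e = - nrm r / (\<bar>F r\<bar> + 1)"
    have "e < 0" using R by (simp add: e_def field_simps)
    moreover have "2 * nrm r + e * F r > 0"
    proof -
      have "\<bar>e * F r\<bar> = nrm r * (\<bar>F r\<bar> / (\<bar>F r\<bar> + 1))" using R by (simp add: e_def abs_mult)
      also have "\<dots> \<le> nrm r * 1" using R by (intro mult_left_mono) auto
      finally show ?thesis using R by linarith
    qed
    ultimately have "e * (2 * nrm r + e * F r) < 0" by (rule mult_neg_pos)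
    then have "F (\<lambda>i. f i + of_real e * r i) < 0"
      unfolding expand by (simp add: algebra_simps power2_eq_square)
    then show False using min[of "\<lambda>i. f i + of_real e * r i"] by (simp add: F_def)
  qed
  then have "\<And>i. i < n \<Longrightarrow> r i = 0" by (auto simp: nrm_def sum_nonneg_eq_0_iff)
  then have "\<And>i. i < n \<Longrightarrow> (\<Sum>j<n. h i j * f j) = of_real \<mu> * f i"
    by (simp add: r_def L_def)
  then show ?thesis by (rule that[OF f1[unfolded nrm_def] _ min[unfolded nrm_def]])
qed

subsection \<open>Condition numbers\<close>

lemma gram_matrix_index:
  fixes A :: "complex mat"
  assumes "A \<in> carrier_mat p q" "i < q" "j < q"
  shows "(mat_adjoint A * A) $$ (i, j) = (\<Sum>s<p. cnj (A $$ (s, i)) * A $$ (s, j))"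
  using assms by (auto simp: mat_adjoint_def scalar_prod_def lessThan_atLeast0)

lemma gram_form:
  fixes a :: "nat \<Rightarrow> nat \<Rightarrow> complex"
  shows "(\<Sum>i<q. \<Sum>j<q. cnj (g i) * (\<Sum>s<p. cnj (a s i) * a s j) * g j) =
    of_real (\<Sum>s<p. (cmod (\<Sum>t<q. a s t * g t))\<^sup>2)"
proof -
  have "(\<Sum>i<q. \<Sum>j<q. cnj (g i) * (\<Sum>s<p. cnj (a s i) * a s j) * g j) =
      (\<Sum>i<q. \<Sum>j<q. \<Sum>s<p. cnj (a s i * g i) * (a s j * g j))"
    by (simp add: sum_distrib_left sum_distrib_right mult_ac)
  also have "\<dots> = (\<Sum>i<q. \<Sum>s<p. \<Sum>j<q. cnj (a s i * g i) * (a s j * g j))"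
    by (intro sum.cong refl sum.swap)
  also have "\<dots> = (\<Sum>s<p. \<Sum>i<q. \<Sum>j<q. cnj (a s i * g i) * (a s j * g j))"
    by (rule sum.swap)
  also have "\<dots> = (\<Sum>s<p. cnj (\<Sum>t<q. a s t * g t) * (\<Sum>t<q. a s t * g t))"
    by (simp add: sum_product)
  also have "\<dots> = of_real (\<Sum>s<p. (cmod (\<Sum>t<q. a s t * g t))\<^sup>2)"
    by (simp add: complex_norm_square mult.commute del: of_real_power)
  finally show ?thesis .
qed

text \<open>Rayleigh quotients: \<open>u\<close> forces the largest eigenvalue of the Gram matrix to
  be at least \<alpha>, and \<open>v\<close> forces the smallest to be at most \<beta>. Injectivity
  makes all eigenvalues positive; a zero singular value would turn the condition number into
  0.\<close>

lemma condition_number_ge: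
  fixes A :: "complex mat" and p q :: nat
  defines "E \<equiv> \<lambda>g. \<Sum>s<p. (cmod (\<Sum>t<q. A $$ (s, t) * g t))\<^sup>2"
    and "nrm \<equiv> \<lambda>g. \<Sum>t<q. (cmod (g t))\<^sup>2"
  assumes A: "A \<in> carrier_mat p q" and q: "0 < q" "q \<le> p"
    and inj: "\<And>g. E g = 0 \<Longrightarrow> nrm g = 0"
    and u: "nrm u > 0" "\<alpha> * nrm u \<le> E u" and v: "nrm v > 0" "E v \<le> \<beta> * nrm v"
  shows "condition_number A \<ge> sqrt \<alpha> / sqrt \<beta>"
proof -
  define h where "h = (\<lambda>i j. \<Sum>s<p. cnj (A $$ (s, i)) * A $$ (s, j))"
  define H where "H = mat_adjoint A * A"
  have H: "H \<in> carrier_mat q q" using A by (auto simp: H_def mat_adjoint_def)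
  have H_index: "H $$ (i, j) = h i j" if "i < q" "j < q" for i j
    using gram_matrix_index[OF A that] by (simp add: H_def h_def)
  have H_mult: "(H *\<^sub>v w) $ i = (\<Sum>j<q. h i j * w $ j)" if "w \<in> carrier_vec q" "i < q" for w i
    using that H by (auto simp: scalar_prod_def lessThan_atLeast0 H_index intro!: sum.cong)
  have form: "(\<Sum>i<q. \<Sum>j<q. cnj (g i) * h i j * g j) = of_real (E g)" for g
    unfolding h_def E_def by (rule gram_form)
  have herm: "h j i = cnj (h i j)" for i j by (simp add: h_def mult.commute)
  have E_nonneg: "E g \<ge> 0" for g unfolding E_def by (intro sum_nonneg) auto
  define C where "C = proots (char_poly H)"
  have cp0: "char_poly H \<noteq> 0" using degree_monic_char_poly[OF H] by auto
  have C_iff: "z \<in># C \<longleftrightarrow> eigenvalue H z" for z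
    using cp0 by (simp add: C_def eigenvalue_root_char_poly[OF H])
  have size_C: "size C = q"
    using degree_monic_char_poly[OF H] by (simp add: C_def size_proots_complex)
  \<comment> \<open>Pairing the eigenvector equation with the eigenvector itself gives
    \<open>E g = Re z * nrm g\<close>.\<close>
  have pos: "Re z > 0" if "z \<in># C" for z
  proof -
    from that obtain w where w: "w \<in> carrier_vec q" "w \<noteq> 0\<^sub>v q" "H *\<^sub>v w = z \<cdot>\<^sub>v w"
      using H by (auto simp: C_iff eigenvalue_def eigenvector_def)
    define g where "g = (\<lambda>i. w $ i)"
    have eq: "(\<Sum>j<q. h i j * g j) = z * g i" if "i < q" for i
      using H_mult[OF w(1) that] w(1,3) that by (simp add: g_def)
    have "complex_of_real (E g) = (\<Sum>i<q. cnj (g i) * (\<Sum>j<q. h i j * g j))"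
      unfolding form[symmetric] by (simp add: sum_distrib_left mult.assoc)
    also have "\<dots> = (\<Sum>i<q. cnj (g i) * (z * g i))" by (intro sum.cong) (auto simp: eq)
    also have "\<dots> = z * of_real (nrm g)"
      by (simp add: nrm_def complex_norm_square sum_distrib_left mult_ac del: of_real_power)
    finally have "Re (of_real (E g)) = Re (z * of_real (nrm g))" by (rule arg_cong)
    then have *: "E g = Re z * nrm g" by simp
    have "nrm g \<noteq> 0"
    proof
      assume "nrm g = 0"
      then have "\<forall>i<q. g i = 0" by (auto simp: nrm_def sum_nonneg_eq_0_iff)
      then have "w = 0\<^sub>v q" using w(1) by (intro eq_vecI) (auto simp: g_def)
      then show False using w(2) by simp
    qed
    moreover have "nrm g \<ge> 0" unfolding nrm_def by (intro sum_nonneg) auto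
    ultimately have "nrm g > 0" "E g \<noteq> 0" using inj by force+
    then show ?thesis using * E_nonneg[of g] by (metis less_le zero_less_mult_pos2)
  qed
  have eigen: "of_real \<mu> \<in># C" if f: "(\<Sum>i<q. (cmod (f i))\<^sup>2) = 1"
    and eq: "\<And>i. i < q \<Longrightarrow> (\<Sum>j<q. h i j * f j) = of_real \<mu> * f i" for \<mu> f
  proof -
    have "vec q f \<noteq> 0\<^sub>v q"
    proof
      assume "vec q f = 0\<^sub>v q"
      then have "\<forall>i<q. f i = 0" by (metis index_vec index_zero_vec(1))
      then show False using f by simp
    qed
    moreover have "H *\<^sub>v vec q f = of_real \<mu> \<cdot>\<^sub>v vec q f"
    proof (intro eq_vecI)
      fix i assume "i < dim_vec (complex_of_real \<mu> \<cdot>\<^sub>v vec q f)"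
      then have "i < q" by simp
      then show "(H *\<^sub>v vec q f) $ i = (complex_of_real \<mu> \<cdot>\<^sub>v vec q f) $ i"
        using eq[of i] by (simp add: H_mult)
    qed (use H in auto)
    ultimately show ?thesis
      using H by (auto simp: C_iff eigenvalue_def eigenvector_def intro!: exI[of _ "vec q f"])
  qed
  obtain \<mu> f where f: "(\<Sum>i<q. (cmod (f i))\<^sup>2) = 1"
      "\<And>i. i < q \<Longrightarrow> (\<Sum>j<q. h i j * f j) = of_real \<mu> * f i"
    and "\<And>g. \<mu> * (\<Sum>i<q. (cmod (g i))\<^sup>2) \<le> Re (\<Sum>i<q. \<Sum>j<q. cnj (g i) * h i j * g j)"
    by (rule hermitian_form_min[of q h, OF q(1) herm]) blast
  then have min: "\<And>g. \<mu> * nrm g \<le> E g" by (simp add: form nrm_def)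
  have \<mu>: "of_real \<mu> \<in># C" using f by (rule eigen)
  \<comment> \<open>The largest eigenvalue comes from minimising the negated form: if \<nu> is the
    minimum for \<open>- h\<close>, then \<open>- \<nu>\<close> is the maximum for
    \<open>h\<close>.\<close>
  have herm_neg: "- h j i = cnj (- h i j)" for i j
    using herm[of j i] by simp
  obtain \<nu> f' where f': "(\<Sum>i<q. (cmod (f' i))\<^sup>2) = 1"
      "\<And>i. i < q \<Longrightarrow> (\<Sum>j<q. - h i j * f' j) = of_real \<nu> * f' i"
    and \<nu>_le: "\<And>g. \<nu> * (\<Sum>i<q. (cmod (g i))\<^sup>2) \<le> Re (\<Sum>i<q. \<Sum>j<q. cnj (g i) * - h i j * g j)"
    by (rule hermitian_form_min[of q "\<lambda>i j. - h i j", OF q(1) herm_neg]) blast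
  have neg_form: "(\<Sum>i<q. \<Sum>j<q. cnj (g i) * - h i j * g j) = - of_real (E g)" for g
    unfolding form[symmetric] by (simp add: sum_negf)
  have max: "\<nu> * nrm g \<le> - E g" for g
    using \<nu>_le[of g] unfolding neg_form nrm_def by simp
  have \<nu>: "of_real (- \<nu>) \<in># C"
  proof (rule eigen[OF f'(1)])
    fix i assume "i < q"
    then show "(\<Sum>j<q. h i j * f' j) = of_real (- \<nu>) * f' i"
      using f'(2)[of i] by (simp add: sum_negf minus_equation_iff)
  qed
  have "\<mu> * nrm v \<le> \<beta> * nrm v" using min[of v] v(2) by linarith
  then have \<beta>: "\<mu> \<le> \<beta>" using v(1) by (rule mult_right_le_imp_le)
  have "\<alpha> * nrm u \<le> (- \<nu>) * nrm u" using max[of u] u(2) by linarith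
  then have \<alpha>: "\<alpha> \<le> - \<nu>" using u(1) by (rule mult_right_le_imp_le)
  define M where "M = image_mset (\<lambda>z. sqrt (Re z)) C"
  define xs where "xs = sorted_list_of_multiset M"
  have xs: "mset xs = M" "sorted xs" by (auto simp: xs_def)
  have len: "length xs = q" using size_C xs(1) by (metis M_def size_image_mset size_mset)
  then have ne: "xs \<noteq> []" using q by auto
  \<comment> \<open>By \<open>q \<le> p\<close> the \<open>take\<close> in the definition keeps all
    \<open>q\<close> entries.\<close>
  have "singular_values A = rev xs"
    using A len q by (simp add: singular_values_def xs_def M_def C_def H_def)
  then have cond: "condition_number A = last xs / hd xs"
    using ne by (simp add: condition_number_def hd_rev last_rev)
  have set_xs: "set xs = set_mset M" using xs(1) by (metis set_mset_mset)
  have hd_le: "hd xs \<le> x" if "x \<in># M" for x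
    using that xs(2) ne set_xs by (metis hd_Cons_tl list.exhaust_sel order_refl set_ConsD sorted_simps(2))
  have last_ge: "x \<le> last xs" if "x \<in># M" for x
    using that xs(2) ne set_xs by (metis append_butlast_last_id order_refl sorted_append list.set_intros(1) set_ConsD Un_iff set_append list.set(1) empty_iff)
  have "hd xs \<in># M" using ne set_xs by (metis hd_in_set)
  then have hd_pos: "hd xs > 0" using pos by (auto simp: M_def)
  have "sqrt \<mu> \<in># M" using imageI[OF \<mu>, of "\<lambda>z. sqrt (Re z)"] by (simp add: M_def)
  then have h1: "hd xs \<le> sqrt \<beta>" using hd_le \<beta> by (meson order_trans real_sqrt_le_iff)
  have "sqrt (- \<nu>) \<in># M" using imageI[OF \<nu>, of "\<lambda>z. sqrt (Re z)"] by (simp add: M_def)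
  then have h2: "sqrt \<alpha> \<le> last xs" using last_ge \<alpha> by (meson order_trans real_sqrt_le_iff)
  have "last xs > 0" using hd_pos hd_le set_xs ne by (metis last_in_set less_le_trans)
  then show ?thesis unfolding cond using h1 h2 hd_pos by (intro frac_le) auto
qed

subsection \<open>The Dolph--Chebyshev window\<close>

text \<open>With z = w^2 this is w^n T_n(b (w + 1/w) / 2). The factor w^n turns the Chebyshev
  recurrence T_(n+2) = 2 x T_(n+1) - T_n into one involving only z, so no half-integer powers
  remain.\<close>

fun cheb_window :: "complex \<Rightarrow> nat \<Rightarrow> complex poly" where
  "cheb_window b 0 = 1"
| "cheb_window b (Suc 0) = Polynomial.smult (b / 2) [:1, 1:]"
| "cheb_window b (Suc (Suc n)) =
     Polynomial.smult b ([:1, 1:] * cheb_window b (Suc n)) - pCons 0 (cheb_window b n)"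

lemma degree_cheb_window: "degree (cheb_window b n) \<le> n"
proof (induction b n rule: cheb_window.induct)
  case (2 b)
  show ?case by (simp add: degree_smult_le[THEN order_trans])
next
  case (3 b n)
  have "degree ([:1, 1:] * cheb_window b (Suc n)) \<le> Suc (Suc n)"
    using 3(1) degree_mult_le[of "[:1, 1:]" "cheb_window b (Suc n)"] by simp
  then have "degree (Polynomial.smult b ([:1, 1:] * cheb_window b (Suc n))) \<le> Suc (Suc n)"
    using degree_smult_le order_trans by blast
  moreover have "degree (pCons 0 (cheb_window b n)) \<le> Suc (Suc n)"
    using 3(2) by (simp add: degree_pCons_le[THEN order_trans])
  ultimately show ?case by (simp add: degree_diff_le)
qed auto

text \<open>At 1 the recurrence becomes the three-term recurrence of \<open>cosh (n * t)\<close>.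
  This large value is what forces large coefficients.\<close>

lemma cheb_window_at_1: "poly (cheb_window (of_real (cosh t)) n) 1 = of_real (cosh (real n * t))"
proof (induction n rule: induct_nat_012)
  case (ge2 n)
  define x where "x = real n * t + t"
  have "cosh (x + t) = 2 * cosh t * cosh x - cosh (x - t)"
    by (simp add: cosh_add cosh_diff)
  then have "cosh (real (Suc (Suc n)) * t) = 2 * cosh t * cosh (real (Suc n) * t) - cosh (real n * t)"
    by (simp add: x_def algebra_simps)
  then show ?case using ge2 by simp
qed auto

text \<open>Both sides obey the same recurrence: 1 + cis(2 \<theta>) = 2 cos \<theta> cis \<theta>
  turns the factor b (1 + z) into 2 cos \<phi> cis \<theta>, and what remains is the three-term
  recurrence of \<open>cos (n * \<phi>)\<close>.\<close>

lemma cheb_window_on_circle: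
  assumes "b * cos \<theta> = cos \<phi>"
  shows "poly (cheb_window (of_real b) n) (cis (2 * \<theta>)) = cis (real n * \<theta>) * of_real (cos (real n * \<phi>))"
proof -
  have one_plus: "1 + cis (2 * \<theta>) = 2 * of_real (cos \<theta>) * cis \<theta>"
    by (simp add: complex_eq_iff cos_double_cos sin_double power2_eq_square)
  have bc: "of_real b * (1 + cis (2 * \<theta>)) = 2 * of_real (cos \<phi>) * cis \<theta>"
    unfolding one_plus assms[symmetric] by simp
  show ?thesis
  proof (induction n rule: induct_nat_012)
    case 1
    then show ?case using bc by (simp add: field_simps)
  next
    case (ge2 n)
    define x where "x = real n * \<phi> + \<phi>"
    have "cos (x + \<phi>) = 2 * cos \<phi> * cos x - cos (x - \<phi>)"
      by (simp add: cos_add cos_diff)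
    then have cos_rec: "cos (real (Suc (Suc n)) * \<phi>) =
        2 * cos \<phi> * cos (real (Suc n) * \<phi>) - cos (real n * \<phi>)"
      by (simp add: x_def algebra_simps)
    have cis1: "cis (real (Suc (Suc n)) * \<theta>) = cis \<theta> * cis (real (Suc n) * \<theta>)"
      and cis2: "cis (real (Suc (Suc n)) * \<theta>) = cis (2 * \<theta>) * cis (real n * \<theta>)"
      by (simp_all add: cis_mult algebra_simps)
    have "poly (cheb_window (of_real b) (Suc (Suc n))) (cis (2 * \<theta>)) =
        of_real b * (1 + cis (2 * \<theta>)) * poly (cheb_window (of_real b) (Suc n)) (cis (2 * \<theta>))
          - cis (2 * \<theta>) * poly (cheb_window (of_real b) n) (cis (2 * \<theta>))"
      by (simp add: algebra_simps)
    also have "\<dots> = 2 * of_real (cos \<phi>) * of_real (cos (real (Suc n) * \<phi>)) * (cis \<theta> * cis (real (Suc n) * \<theta>))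
          - (cis (2 * \<theta>) * cis (real n * \<theta>)) * of_real (cos (real n * \<phi>))"
      unfolding ge2 bc by (simp only: mult_ac)
    also have "\<dots> = cis (real (Suc (Suc n)) * \<theta>) * of_real (cos (real (Suc (Suc n)) * \<phi>))"
      unfolding cis1[symmetric] cis2[symmetric] cos_rec by (simp add: algebra_simps)
    finally show ?case .
  qed auto
qed

lemma cheb_window_stopband:
  assumes "\<bar>b * cos \<theta>\<bar> \<le> 1"
  shows "cmod (poly (cheb_window (of_real b) n) (cis (2 * \<theta>))) \<le> 1"
proof -
  have "b * cos \<theta> = cos (arccos (b * cos \<theta>))"
    using assms by (simp add: cos_arccos_abs)
  from cheb_window_on_circle[OF this] show ?thesis by (simp add: norm_mult)
qed

text \<open>The product is 1 at 0 and decreasing: its derivative sinh cos - cosh sin vanishes at 0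
  and itself has derivative -2 sinh sin, which is nonpositive here.\<close>

lemma cosh_mult_cos_le_1:
  fixes x :: real
  assumes "0 \<le> x" "x \<le> pi / 2"
  shows "cosh x * cos x \<le> 1"
proof -
  have "sinh y * cos y - cosh y * sin y \<le> sinh 0 * cos 0 - cosh 0 * sin 0"
    if "0 \<le> y" "y \<le> pi / 2" for y :: real
  proof (rule DERIV_nonpos_imp_nonincreasing[OF that(1)])
    fix z assume z: "0 \<le> z" "z \<le> y"
    have "((\<lambda>y. sinh y * cos y - cosh y * sin y) has_real_derivative - 2 * sinh z * sin z) (at z)"
      by (auto intro!: derivative_eq_intros simp: algebra_simps)
    moreover have "- 2 * sinh z * sin z \<le> 0"
      using z that sin_ge_zero[of z] by auto
    ultimately show "\<exists>d. ((\<lambda>y. sinh y * cos y - cosh y * sin y) has_real_derivative d) (at z) \<and> d \<le> 0"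
      by blast
  qed
  then have neg: "sinh y * cos y - cosh y * sin y \<le> 0" if "0 \<le> y" "y \<le> pi / 2" for y :: real
    using that by simp
  have "cosh x * cos x \<le> cosh 0 * cos 0"
  proof (rule DERIV_nonpos_imp_nonincreasing[OF assms(1)])
    fix z assume z: "0 \<le> z" "z \<le> x"
    have "((\<lambda>y. cosh y * cos y) has_real_derivative (sinh z * cos z - cosh z * sin z)) (at z)"
      by (auto intro!: derivative_eq_intros simp: algebra_simps)
    then show "\<exists>d. ((\<lambda>y. cosh y * cos y) has_real_derivative d) (at z) \<and> d \<le> 0"
      using neg[of z] z assms by auto
  qed
  then show ?thesis by simp
qed

subsection \<open>Submatrices of the Fourier matrix\<close>

lemma dft_entry_cis: "dft_entry N j k = cis (2 * pi * (of_int j * of_int k / of_nat N))"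
  by (simp add: dft_entry_def cis_conv_exp mult_ac)

text \<open>Lets the representatives in \<open>dft_indices\<close> be replaced by consecutive
  integers \<open>a + i\<close> and \<open>b + i\<close>, even where an index set wraps
  around.\<close>

lemma dft_entry_mod:
  assumes "[j = j'] (mod int N)" "[k = k'] (mod int N)" "N > 0"
  shows "dft_entry N j k = dft_entry N j' k'"
proof -
  have "[j * k = j' * k'] (mod int N)" using assms by (intro cong_mult)
  then obtain m where "j * k = j' * k' + int N * m"
    by (metis cong_iff_lin mult.commute cong_sym)
  then have "real_of_int (j * k) = real_of_int (j' * k' + int N * m)" by (rule arg_cong)
  then have "of_int j * of_int k / real N = of_int j' * of_int k' / real N + of_int m"
    using assms(3) by (simp add: field_simps)
  then show ?thesis
    by (simp add: dft_entry_cis distrib_left cis_mult[symmetric] cis_multiple_2pi del: times_divide_eq_right)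
qed

lemma norm_dft_entry [simp]: "cmod (dft_entry N j k) = 1"
  by (simp add: dft_entry_cis)

lemma dft_entry_add: "dft_entry N j (k + l) = dft_entry N j k * dft_entry N j l"
  by (simp add: dft_entry_cis cis_mult add_divide_distrib algebra_simps)

lemma dft_entry_nat: "dft_entry N j (int m) = dft_entry N j 1 ^ m"
  by (simp add: dft_entry_cis DeMoivre mult_ac)

lemma dft_indices_cong_eq:
  assumes "j \<in> dft_indices N" "k \<in> dft_indices N" "[j = k] (mod int N)"
  shows "j = k"
proof (rule ccontr)
  assume "j \<noteq> k"
  have "real_of_int \<bar>j - k\<bar> < real N" using assms by (auto simp: dft_indices_def abs_if)
  then have "\<bar>j - k\<bar> < int N" by linarith
  moreover have "int N dvd \<bar>j - k\<bar>" using assms(3) by (simp add: cong_iff_dvd_diff)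
  ultimately show False using \<open>j \<noteq> k\<close> zdvd_imp_le[of "int N" "\<bar>j - k\<bar>"] by simp
qed

text \<open>Distinct rows give distinct nodes, so that roots of a polynomial can be counted.\<close>

lemma inj_on_dft_node:
  assumes "N > 0"
  shows "inj_on (\<lambda>j. dft_entry N j 1) (dft_indices N)"
proof (rule inj_onI)
  fix j k assume jk: "j \<in> dft_indices N" "k \<in> dft_indices N" "dft_entry N j 1 = dft_entry N k 1"
  then have "cis (2 * pi * of_int j / of_nat N) = cis (2 * pi * of_int k / of_nat N)"
    by (simp add: dft_entry_cis)
  then have "\<exists>m::int. 2 * pi * of_int j / of_nat N = 2 * pi * of_int k / of_nat N + 2 * pi * of_int m"
    by (intro sin_cos_eq_iff[THEN iffD1]) (auto simp: complex_eq_iff)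
  then obtain m :: int where "2 * pi * of_int j / of_nat N = 2 * pi * of_int k / of_nat N + 2 * pi * of_int m" ..
  then have "2 * pi * real_of_int j = 2 * pi * of_int (k + int N * m)"
    using assms by (simp add: field_simps)
  then have "j = k + int N * m" by (simp only: mult_cancel_left of_int_eq_iff) simp
  then have "[j = k] (mod int N)" by (simp add: cong_iff_dvd_diff)
  with jk show "j = k" by (intro dft_indices_cong_eq)
qed

text \<open>The test vectors for \<open>condition_number_ge\<close> are a unit vector, with quotient
  \<open>p\<close>, and the window coefficients, with quotient at most \<open>p * q / G^2\<close>,
  where \<open>G\<close> is half the exponential in the bound.\<close>

theorem condition_number_dft_ge:
  assumes q: "0 < q" "q \<le> p" "p \<le> N" and "cyclic_dft_submatrix N p q A"
  shows "condition_number A \<ge>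
    exp (pi / 2 * (1 - (real p - 1) / real N) * (real q - 1)) / (2 * sqrt (real q))"
proof -
  have N: "N > 0" using q by simp
  obtain a b r c where r: "bij_betw r {..<p} (cyclic_interval N a p)"
    and c: "bij_betw c {..<q} (cyclic_interval N b q)"
    and A: "A = mat p q (\<lambda>(s, t). dft_entry N (r s) (c t))"
    using assms(4) by (auto simp: cyclic_dft_submatrix_def)
  have "r s \<in> cyclic_interval N a p" if "s < p" for s using bij_betwE[OF r] that by auto
  then have "\<forall>s\<in>{..<p}. \<exists>i<p. [r s = a + int i] (mod int N)"
    by (auto simp: cyclic_interval_def)
  \<comment> \<open>\<open>\<rho> s\<close>, and below \<open>\<tau> t\<close>, is the position of
    row \<open>s\<close> or column \<open>t\<close> in cyclic order, independent of the order in
    which the indices are listed.\<close>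
  then obtain \<rho> where \<rho>: "\<And>s. s < p \<Longrightarrow> \<rho> s < p" "\<And>s. s < p \<Longrightarrow> [r s = a + int (\<rho> s)] (mod int N)"
    by (metis lessThan_iff)
  have r_ind: "r ` {..<p} \<subseteq> dft_indices N"
    using r by (auto simp: bij_betw_def cyclic_interval_def)
  have cc: "c t \<in> cyclic_interval N b q" if "t < q" for t using bij_betwE[OF c] that by auto
  then have "\<forall>t\<in>{..<q}. \<exists>i<q. [c t = b + int i] (mod int N)"
    by (auto simp: cyclic_interval_def)
  then obtain \<tau> where \<tau>: "\<And>t. t < q \<Longrightarrow> \<tau> t < q" "\<And>t. t < q \<Longrightarrow> [c t = b + int (\<tau> t)] (mod int N)"
    by (metis lessThan_iff)
  have "inj_on \<tau> {..<q}"
  proof (rule inj_onI)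
    fix t t' assume t: "t \<in> {..<q}" "t' \<in> {..<q}" "\<tau> t = \<tau> t'"
    then have "[c t = c t'] (mod int N)" using \<tau>(2)[of t] \<tau>(2)[of t'] by (metis cong_sym cong_trans lessThan_iff)
    moreover have "c t \<in> dft_indices N" "c t' \<in> dft_indices N"
      using cc t by (auto simp: cyclic_interval_def)
    ultimately have "c t = c t'" by (intro dft_indices_cong_eq)
    then show "t = t'" using c t by (auto simp: bij_betw_def inj_on_def)
  qed
  then have \<tau>_bij: "bij_betw \<tau> {..<q} {..<q}"
    using \<tau>(1) by (intro bij_betw_imageI endo_inj_surj) auto
  define \<sigma> where "\<sigma> = inv_into {..<q} \<tau>"
  have \<sigma>_bij: "bij_betw \<sigma> {..<q} {..<q}" unfolding \<sigma>_def by (rule bij_betw_inv_into[OF \<tau>_bij])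
  have \<sigma>\<tau>: "\<sigma> (\<tau> t) = t" if "t < q" for t
    unfolding \<sigma>_def using \<tau>_bij that by (simp add: bij_betw_def)
  define z where "z = (\<lambda>s. dft_entry N (r s) 1)"
  \<comment> \<open>Up to a unimodular factor from the offset \<open>b\<close>, each row is a
    Vandermonde row with its columns permuted by \<tau>.\<close>
  have entry: "A $$ (s, t) = dft_entry N (r s) b * z s ^ \<tau> t" if "s < p" "t < q" for s t
  proof -
    have "A $$ (s, t) = dft_entry N (r s) (b + int (\<tau> t))"
      using that \<tau>(2)[of t] N by (simp add: A dft_entry_mod)
    then show ?thesis by (simp add: dft_entry_add dft_entry_nat z_def)
  qed
  have apply_A: "cmod (\<Sum>t<q. A $$ (s, t) * g t) = cmod (\<Sum>i<q. z s ^ i * g (\<sigma> i))" if "s < p" for s g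
  proof -
    have "(\<Sum>t<q. A $$ (s, t) * g t) = (\<Sum>t<q. dft_entry N (r s) b * (z s ^ \<tau> t * g (\<sigma> (\<tau> t))))"
      using that by (intro sum.cong) (auto simp: entry \<sigma>\<tau>)
    also have "\<dots> = dft_entry N (r s) b * (\<Sum>t<q. z s ^ \<tau> t * g (\<sigma> (\<tau> t)))"
      by (simp only: sum_distrib_left)
    also have "(\<Sum>t<q. z s ^ \<tau> t * g (\<sigma> (\<tau> t))) = (\<Sum>i<q. z s ^ i * g (\<sigma> i))"
      by (rule sum.reindex_bij_betw[OF \<tau>_bij])
    finally show ?thesis by (simp add: norm_mult)
  qed
  define E where "E = (\<lambda>g. \<Sum>s<p. (cmod (\<Sum>t<q. A $$ (s, t) * g t))\<^sup>2)"
  define nrm where "nrm = (\<lambda>g::nat \<Rightarrow> complex. \<Sum>t<q. (cmod (g t))\<^sup>2)"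
  have nrm_\<sigma>: "nrm g = (\<Sum>i<q. (cmod (g (\<sigma> i)))\<^sup>2)" for g
    unfolding nrm_def by (rule sum.reindex_bij_betw[OF \<sigma>_bij, symmetric])
  \<comment> \<open>A kernel vector is the coefficient vector of a polynomial of degree below
    \<open>q\<close> with \<open>p \<ge> q\<close> distinct roots.\<close>
  have inj: "nrm g = 0" if "E g = 0" for g
  proof -
    define P where "P = (\<Sum>i<q. Polynomial.monom (g (\<sigma> i)) i)"
    have coeff_P: "coeff P i = g (\<sigma> i)" if "i < q" for i
      using that by (simp add: P_def coeff_sum)
    have "degree P \<le> q - 1"
      unfolding P_def by (intro degree_sum_le) (auto intro: order_trans[OF degree_monom_le])
    then have deg: "degree P < p" using q by linarith
    have "inj_on (\<lambda>s. dft_entry N (r s) 1) {..<p}"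
      using comp_inj_on[OF bij_betw_imp_inj_on[OF r] inj_on_subset[OF inj_on_dft_node[OF N]]] r_ind
        bij_betw_imp_surj_on[OF r] by (simp add: o_def)
    then have "card (z ` {..<p}) = p" by (simp add: card_image z_def)
    moreover have "poly P (z s) = 0" if "s < p" for s
    proof -
      have "cmod (\<Sum>t<q. A $$ (s, t) * g t) = 0"
        using \<open>E g = 0\<close> that by (auto simp: E_def sum_nonneg_eq_0_iff)
      then show ?thesis
        using apply_A[OF that, of g] by (simp add: P_def poly_sum poly_monom mult.commute)
    qed
    then have "z ` {..<p} \<subseteq> {x. poly P x = 0}" by auto
    ultimately have "P = 0" using deg poly_roots_degree[of P] poly_roots_finite[of P]
      by (metis card_mono leD le_trans)
    then show ?thesis using coeff_P by (simp add: nrm_\<sigma>)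
  qed
  \<comment> \<open>The \<open>p\<close> nodes span \<open>p - 1\<close> gaps, so in half-angles
    they lie within \<open>pi * (p - 1) / (2 * N) = pi / 2 - \<theta>\<close> of the middle of their
    arc.\<close>
  define \<theta> where "\<theta> = pi / 2 * (1 - (real p - 1) / real N)"
  have frac: "(real p - 1) / real N \<le> 1" "0 \<le> (real p - 1) / real N" using q by auto
  have \<theta>: "0 \<le> \<theta>" "\<theta> \<le> pi / 2" using frac by (auto simp: \<theta>_def intro: mult_left_le)
  define P where "P = cheb_window (of_real (cosh \<theta>)) (q - 1)"
  \<comment> \<open>Rotation taking the middle of the row arc, at angle
    \<open>pi * (2 * a + p - 1) / N\<close>, to -1, opposite to the point 1 where the window is
    large.\<close>
  define \<omega> where "\<omega> = cis (pi - pi * (2 * of_int a + real p - 1) / real N)"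
  define v where "v = (\<lambda>t. coeff P (\<tau> t) * \<omega> ^ \<tau> t)"
  have v_\<sigma>: "v (\<sigma> i) = coeff P i * \<omega> ^ i" if "i < q" for i
    using that \<tau>_bij by (simp add: v_def \<sigma>_def bij_betw_inv_into_right)
  have poly_P: "poly P x = (\<Sum>i<q. coeff P i * x ^ i)" for x
  proof -
    have "degree P \<le> q - 1" by (simp add: P_def degree_cheb_window)
    then have "degree P < q" using q by linarith
    then show ?thesis unfolding poly_altdef
      by (intro sum.mono_neutral_left) (auto simp: coeff_eq_0)
  qed
  have row: "cmod (\<Sum>t<q. A $$ (s, t) * v t) \<le> 1" if s: "s < p" for s
  proof -
    \<comment> \<open>Signed half-angle from -1 to the rotated node. The stopband estimate then
      follows from \<open>\<bar>cos (x + pi / 2)\<bar> = \<bar>sin x\<bar> \<le> cos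
      \<theta>\<close>.\<close>
    define x where "x = pi * (2 * real (\<rho> s) - (real p - 1)) / (2 * real N)"
    have "dft_entry N (r s) 1 = dft_entry N (a + int (\<rho> s)) 1"
      using \<rho>(2)[OF s] N by (intro dft_entry_mod) auto
    moreover have "(pi - pi * (2 * of_int a + real p - 1) / real N)
        + 2 * pi * (of_int (a + int (\<rho> s)) / real N) = 2 * (x + pi / 2)"
    proof -
      have "2 * x = pi * (2 * real (\<rho> s) - (real p - 1)) / real N" by (simp add: x_def)
      then show ?thesis by (simp add: add_divide_distrib diff_divide_distrib algebra_simps)
    qed
    ultimately have node: "\<omega> * z s = cis (2 * (x + pi / 2))"
      by (simp only: \<omega>_def z_def dft_entry_cis cis_mult of_int_1 mult_1_right)
    then have "(\<Sum>i<q. z s ^ i * v (\<sigma> i)) = poly P (cis (2 * (x + pi / 2)))"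
      unfolding poly_P node[symmetric] by (auto simp: v_\<sigma> power_mult_distrib mult_ac)
    moreover have "cmod (poly P (cis (2 * (x + pi / 2)))) \<le> 1"
      unfolding P_def
    proof (rule cheb_window_stopband)
      have "real (Suc (\<rho> s)) \<le> real p" using \<rho>(1)[OF s] by (simp only: of_nat_le_iff Suc_le_eq)
      then have "real (\<rho> s) + 1 \<le> real p" by simp
      then have "\<bar>2 * real (\<rho> s) - (real p - 1)\<bar> \<le> real p - 1" by linarith
      then have "\<bar>x\<bar> \<le> pi * (real p - 1) / (2 * real N)"
        using mult_left_mono[of _ "real p - 1" pi] by (simp add: x_def abs_mult divide_right_mono)
      also have "\<dots> = pi / 2 - \<theta>" by (simp add: \<theta>_def field_simps)
      finally have x: "\<bar>x\<bar> \<le> pi / 2 - \<theta>" .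
      have "\<bar>cos (x + pi / 2)\<bar> = \<bar>sin x\<bar>" by (simp add: cos_add)
      also have "\<dots> = sin \<bar>x\<bar>" using x \<theta> sin_ge_zero[of x] sin_ge_zero[of "- x"] by (cases "x \<ge> 0") auto
      also have "\<dots> \<le> sin (pi / 2 - \<theta>)" using x \<theta> by (intro sin_monotone_2pi_le) auto
      also have "\<dots> = cos \<theta>" by (simp add: sin_diff)
      finally have "cosh \<theta> * \<bar>cos (x + pi / 2)\<bar> \<le> cosh \<theta> * cos \<theta>" by (intro mult_left_mono) auto
      also have "\<dots> \<le> 1" using \<theta> by (rule cosh_mult_cos_le_1)
      finally show "\<bar>cosh \<theta> * cos (x + pi / 2)\<bar> \<le> 1" by (simp add: abs_mult)
    qed
    ultimately show ?thesis using apply_A[OF s, of v] by simp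
  qed
  \<comment> \<open>\<open>G\<close> bounds the value of the window at 1 from below; Cauchy-Schwarz
    over the \<open>q\<close> coefficients converts it into a bound on \<open>nrm v\<close>.\<close>
  define G where "G = exp (\<theta> * (real q - 1)) / 2"
  have G: "G > 0" by (simp add: G_def)
  have "G \<le> cosh (real (q - 1) * \<theta>)"
    using q by (simp add: G_def cosh_def of_nat_diff mult.commute)
  also have "\<dots> = cmod (poly P 1)" by (simp add: P_def cheb_window_at_1)
  also have "\<dots> \<le> (\<Sum>i<q. cmod (coeff P i))" by (simp add: poly_P norm_sum)
  finally have "G\<^sup>2 \<le> (\<Sum>i<q. cmod (coeff P i))\<^sup>2" using G by (intro power_mono) auto
  also have "\<dots> \<le> real q * (\<Sum>i<q. (cmod (coeff P i))\<^sup>2)" using sum_squared_le_sum_of_squares[of "\<lambda>i. cmod (coeff P i)" "{..<q}"] by (simp add: mult.commute)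
  also have "(\<Sum>i<q. (cmod (coeff P i))\<^sup>2) = nrm v"
    unfolding nrm_\<sigma> by (intro sum.cong) (auto simp: v_\<sigma> norm_mult norm_power \<omega>_def)
  finally have nrm_v: "G\<^sup>2 / real q \<le> nrm v" using q by (simp add: field_simps)
  have "0 < G\<^sup>2 / real q" using G q by simp
  then have nrm_v_pos: "nrm v > 0" using nrm_v by linarith
  have "E v \<le> (\<Sum>s<p. 1)" unfolding E_def using row by (intro sum_mono) (auto simp: power_le_one)
  then have "E v \<le> real p" by simp
  also have "real p = real p * real q / G\<^sup>2 * (G\<^sup>2 / real q)" using G q by simp
  also have "\<dots> \<le> real p * real q / G\<^sup>2 * nrm v" using nrm_v by (intro mult_left_mono) auto
  finally have E_v: "E v \<le> real p * real q / G\<^sup>2 * nrm v" .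
  \<comment> \<open>\<open>A u\<close> is the first column, whose \<open>p\<close> entries are
    unimodular.\<close>
  define u where "u = (\<lambda>t::nat. if t = 0 then 1 else 0 :: complex)"
  have nrm_u: "nrm u = 1"
  proof -
    have "nrm u = (\<Sum>t<q. if t = 0 then 1 else 0)" unfolding nrm_def u_def by (intro sum.cong) auto
    then show ?thesis using q by simp
  qed
  have "E u = (\<Sum>s<p. 1)" unfolding E_def
  proof (intro sum.cong refl)
    fix s assume "s \<in> {..<p}"
    then have s: "s < p" by simp
    have "(\<Sum>t<q. A $$ (s, t) * u t) = (\<Sum>t<q. if t = 0 then A $$ (s, t) else 0)"
      unfolding u_def by (intro sum.cong) auto
    also have "\<dots> = A $$ (s, 0)" using q by simp
    finally show "(cmod (\<Sum>t<q. A $$ (s, t) * u t))\<^sup>2 = 1"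
      using s q by (simp add: A)
  qed
  then have E_u: "real p * nrm u \<le> E u" using nrm_u by simp
  have "A \<in> carrier_mat p q" by (simp add: A)
  moreover have "nrm u > 0" using nrm_u by simp
  ultimately have "sqrt (real p) / sqrt (real p * real q / G\<^sup>2) \<le> condition_number A"
    using condition_number_ge[of A p q u "real p" v "real p * real q / G\<^sup>2"]
      q inj E_u nrm_v_pos E_v unfolding E_def nrm_def by blast
  also have "sqrt (real p) / sqrt (real p * real q / G\<^sup>2) = G / sqrt (real q)"
    using q G by (simp add: real_sqrt_mult real_sqrt_divide)
  finally show ?thesis by (simp add: G_def \<theta>_def)
qed

section \<open>Rounded parameters and comparison with the stated bound\<close>

lemma largest_even_below_bounds:
  assumes "2 < q"
  shows "2 \<le> largest_even_below q" "largest_even_below q < q" "q \<le> largest_even_below q + 2"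
proof -
  have bound: "\<And>y. even y \<and> y < q \<Longrightarrow> y \<le> q" by simp
  have "even (2 * ((q - 1) div 2)) \<and> 2 * ((q - 1) div 2) < q" using assms by auto
  from GreatestI_nat[where P = "\<lambda>m. even m \<and> m < q", OF this bound]
    Greatest_le_nat[where P = "\<lambda>m. even m \<and> m < q", OF this bound]
  show "2 \<le> largest_even_below q" "largest_even_below q < q" "q \<le> largest_even_below q + 2"
    using assms unfolding largest_even_below_def by auto
qed

lemma least_same_parity_above_bounds:
  "p < least_same_parity_above N p" "least_same_parity_above N p \<le> p + 2"
proof -
  define m where "m = (if even N = even p then p + 2 else p + 1)"
  have "even m = even N \<and> p < m" by (auto simp: m_def)
  from LeastI[of "\<lambda>m. even m = even N \<and> p < m", OF this] Least_le[of "\<lambda>m. even m = even N \<and> p < m", OF this]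
  show "p < least_same_parity_above N p" "least_same_parity_above N p \<le> p + 2"
    unfolding least_same_parity_above_def by (auto simp: m_def split: if_splits)
qed

theorem theorem1:
  fixes N p q :: nat and A :: "complex mat"
  assumes "2 < q" and "q \<le> p" and "p + 2 < N"
    and "cyclic_dft_submatrix N p q A"
  defines "qbar \<equiv> real (largest_even_below q)"
    and "pbar \<equiv> real (least_same_parity_above N p)"
  shows "condition_number A \<ge>
    sqrt (real p) * (1 - pbar / real N) powr (1 / 4)
      / (6 * qbar powr (1 / 4) * sqrt (real N))
      * exp (pi / 4 * (1 - pbar / real N) * qbar)"
proof -
  define \<gamma> where "\<gamma> = 1 - pbar / real N"
  have qb: "2 \<le> qbar" "qbar \<le> real q - 1" "real q \<le> 2 * qbar"
    using largest_even_below_bounds[OF assms(1)] by (auto simp: qbar_def)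
  \<comment> \<open>The first fact rests on \<open>pbar \<le> p + 2 < N\<close> and makes \<gamma>
    positive; the second bounds \<gamma> by the rate of
    \<open>condition_number_dft_ge\<close>.\<close>
  have "pbar < real N" "real p - 1 \<le> pbar"
    using least_same_parity_above_bounds[where N = N and p = p] assms(3) by (auto simp: pbar_def)
  then have \<gamma>: "0 < \<gamma>" "\<gamma> \<le> 1 - (real p - 1) / real N"
    using assms(3) by (auto simp: \<gamma>_def divide_right_mono)
  \<comment> \<open>In terms of \<open>y\<close>, the claimed exponent is \<open>pi / 4 * y\<close>,
    while \<open>pi / 2 * y\<close> is available.\<close>
  define y where "y = \<gamma> * qbar"
  have y: "y > 0" using \<gamma> qb by (simp add: y_def)
  have "sqrt (real p) \<le> sqrt (real N)" using assms(3) by simp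
  then have "sqrt (real p) * \<gamma> powr (1/4) / (6 * qbar powr (1/4) * sqrt (real N)) * exp (pi / 4 * \<gamma> * qbar)
    \<le> sqrt (real N) * \<gamma> powr (1/4) / (6 * qbar powr (1/4) * sqrt (real N)) * exp (pi / 4 * \<gamma> * qbar)"
    by (intro mult_right_mono divide_right_mono) auto
  also have "\<dots> = \<gamma> powr (1/4) / (6 * qbar powr (1/4)) * exp (pi / 4 * y)"
    using assms(3) by (simp add: y_def mult_ac)
  also have "\<dots> = y powr (1/4) / (6 * sqrt qbar) * exp (pi / 4 * y)"
  proof -
    have "sqrt qbar = qbar powr (1/4) * qbar powr (1/4)"
      using qb powr_half_sqrt[of qbar] by (simp flip: powr_add)
    then show ?thesis using \<gamma> qb by (simp add: y_def powr_mult)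
  qed
  also have "\<dots> \<le> exp (pi / 4 * y) / (6 * sqrt qbar) * exp (pi / 4 * y)"
  proof -
    \<comment> \<open>The surplus exponent \<open>pi / 4 * y\<close> is spent on absorbing the
      factor \<open>y powr (1/4)\<close>.\<close>
    have "y \<le> exp y" using exp_ge_add_one_self[of y] by linarith
    then have "y powr (1/4) \<le> exp y powr (1/4)" using y by (intro powr_mono2) auto
    also have "\<dots> = exp (1 / 4 * y)" by (simp add: exp_powr_real)
    also have "\<dots> \<le> exp (pi / 4 * y)" using mult_right_mono[of 1 pi y] y pi_ge_two by simp
    finally show ?thesis using qb by (intro mult_right_mono divide_right_mono) auto
  qed
  also have "\<dots> = exp (pi / 2 * y) / (6 * sqrt qbar)" by (simp add: mult_exp_exp)
  also have "\<dots> \<le> exp (pi / 2 * (1 - (real p - 1) / real N) * (real q - 1)) / (2 * sqrt (real q))"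
  proof (rule frac_le)
    have "y \<le> (1 - (real p - 1) / real N) * (real q - 1)"
      unfolding y_def using \<gamma> qb by (intro mult_mono) auto
    then show "exp (pi / 2 * y) \<le> exp (pi / 2 * (1 - (real p - 1) / real N) * (real q - 1))"
      by (simp add: mult.assoc)
    \<comment> \<open>The constant 6 leaves ample room: \<open>q \<le> 9 * qbar\<close> suffices,
      and \<open>q \<le> qbar + 2\<close> with \<open>qbar \<ge> 2\<close> gave
      \<open>q \<le> 2 * qbar\<close>.\<close>
    have "sqrt (real q) \<le> sqrt (9 * qbar)" using qb by (intro real_sqrt_le_mono) linarith
    then show "2 * sqrt (real q) \<le> 6 * sqrt qbar" by (simp add: real_sqrt_mult)
  qed (use assms(1) in auto)
  also have "\<dots> \<le> condition_number A"
    using assms by (intro condition_number_dft_ge) auto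
  finally show ?thesis by (simp only: \<gamma>_def)
qed

end
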